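(* Let $w\in\mathbb{R}^p$ and $\rho>0$, and assume $g_f(w)\neq0$, $g_r(w)\neq0$ and $q(w)\neq0$. Then $$\|\delta_{\mathrm{rosu}}(w)-\delta_{\mathrm{std}}(w)\|_2=\rho\sqrt{2\bigl(1-\sin\theta(w)\bigr)}=\rho\sqrt{2\Bigl(1-\sqrt{1-\cos^2\theta(w)}\Bigr)}.$$ Consequently, if $|\cos\theta(w)|\le\epsilon$ for some $\epsilon\in[0,1]$, then $$\|\delta_{\mathrm{rosu}}(w)-\delta_{\mathrm{std}}(w)\|_2\le\sqrt2\,\rho\,\epsilon.$$ If, in addition, $L_r$ is $G_r$-Lipschitz on the segment $$\mathcal S_\rho(w)=\bigl\{w+t\,\delta_{\mathrm{rosu}}(w)+(1-t)\,\delta_{\mathrm{std}}(w):t\in[0,1]\bigr\},$$ then $$\bigl|L_r(w+\delta_{\mathrm{rosu}}(w))-L_r(w+\delta_{\mathrm{std}}(w))\bigr|\le\sqrt2\,G_r\,\rho\,\epsilon.$$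
   Context: $L_f,L_r:\mathbb{R}^p\to\mathbb{R}$ are differentiable functions (forget and retain losses), with gradients $g_f(w)=\nabla L_f(w)$ and $g_r(w)=\nabla L_r(w)$. For nonzero $g_f(w),g_r(w)$, the angle $\theta(w)\in[0,\pi]$ is defined by $\cos\theta(w)=\dfrac{g_f(w)^\top g_r(w)}{\|g_f(w)\|_2\|g_r(w)\|_2}$. Put $P_r(w)=\dfrac{g_r(w)g_r(w)^\top}{\|g_r(w)\|_2^2}$, $q(w)=(I-P_r(w))g_f(w)$, and $$\delta_{\mathrm{std}}(w)=\rho\,\frac{g_f(w)}{\|g_f(w)\|_2},\qquad \delta_{\mathrm{rosu}}(w)=\rho\,\frac{q(w)}{\|q(w)\|_2}.$$ *)

theory Defs
  imports "HOL-Analysis.Analysis"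
begin

definition gradient :: "(real ^ 'p \<Rightarrow> real) \<Rightarrow> real ^ 'p \<Rightarrow> real ^ 'p" where
  "gradient L w = (THE g. GDERIV L w :> g)"

lemma GDERIV_gradient:
  assumes "L differentiable (at w)"
  shows "GDERIV L w :> gradient L w"
proof -
  obtain D where D: "(L has_derivative D) (at w)"
    using assms by (auto simp: differentiable_def)
  then interpret bounded_linear D
    by (rule has_derivative_bounded_linear)
  have "D = (\<lambda>h. h \<bullet> adjoint D 1)"
    using adjoint_works[of D _ 1] by (simp add: linear_axioms fun_eq_iff)
  with D have ex: "GDERIV L w :> adjoint D 1"
    unfolding gderiv_def by metis
  have "g = adjoint D 1" if "GDERIV L w :> g" for g
    using has_derivative_unique[OF that[unfolded gderiv_def] ex[unfolded gderiv_def]]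
    by (metis vector_eq_ldot)
  with ex show ?thesis
    unfolding gradient_def by (rule theI)
qed

definition vec_angle :: "real ^ 'p \<Rightarrow> real ^ 'p \<Rightarrow> real" where
  "vec_angle u v = arccos ((u \<bullet> v) / (norm u * norm v))"

lemma vec_angle:
  assumes "u \<noteq> 0" "v \<noteq> 0"
  shows "cos (vec_angle u v) = (u \<bullet> v) / (norm u * norm v)"
    and "vec_angle u v \<in> {0..pi}"
proof -
  have "\<bar>(u \<bullet> v) / (norm u * norm v)\<bar> \<le> 1"
    using assms Cauchy_Schwarz_ineq2[of u v] by (simp add: abs_mult divide_le_eq)
  then have "-1 \<le> (u \<bullet> v) / (norm u * norm v)" "(u \<bullet> v) / (norm u * norm v) \<le> 1"
    by linarith+
  then show "cos (vec_angle u v) = (u \<bullet> v) / (norm u * norm v)" "vec_angle u v \<in> {0..pi}"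
    unfolding vec_angle_def atLeastAtMost_iff
    by (blast intro: cos_arccos arccos_lbound arccos_ubound)+
qed

definition line_proj :: "real ^ 'p \<Rightarrow> real ^ 'p ^ 'p" where
  "line_proj v = (1 / (norm v)\<^sup>2) *\<^sub>R ((columnvector v :: real ^ 1 ^ 'p) ** (rowvector v :: real ^ 'p ^ 1))"

definition theta :: "(real ^ 'p \<Rightarrow> real) \<Rightarrow> (real ^ 'p \<Rightarrow> real) \<Rightarrow> real ^ 'p \<Rightarrow> real" where
  "theta Lf Lr w = vec_angle (gradient Lf w) (gradient Lr w)"

definition residual :: "(real ^ 'p \<Rightarrow> real) \<Rightarrow> (real ^ 'p \<Rightarrow> real) \<Rightarrow> real ^ 'p \<Rightarrow> real ^ 'p" where
  "residual Lf Lr w = (mat 1 - line_proj (gradient Lr w)) *v gradient Lf w"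

definition delta_std :: "(real ^ 'p \<Rightarrow> real) \<Rightarrow> real \<Rightarrow> real ^ 'p \<Rightarrow> real ^ 'p" where
  "delta_std Lf \<rho> w = (\<rho> / norm (gradient Lf w)) *\<^sub>R gradient Lf w"

definition delta_rosu ::
  "(real ^ 'p \<Rightarrow> real) \<Rightarrow> (real ^ 'p \<Rightarrow> real) \<Rightarrow> real \<Rightarrow> real ^ 'p \<Rightarrow> real ^ 'p" where
  "delta_rosu Lf Lr \<rho> w = (\<rho> / norm (residual Lf Lr w)) *\<^sub>R residual Lf Lr w"

definition perturbation_segment ::
  "(real ^ 'p \<Rightarrow> real) \<Rightarrow> (real ^ 'p \<Rightarrow> real) \<Rightarrow> real \<Rightarrow> real ^ 'p \<Rightarrow> (real ^ 'p) set" where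
  "perturbation_segment Lf Lr \<rho> w =
     {w + t *\<^sub>R delta_rosu Lf Lr \<rho> w + (1 - t) *\<^sub>R delta_std Lf \<rho> w | t. t \<in> {0..1}}"

end

theory Submission
  imports Defs
begin

text \<open>
  With s the sine of the angle between the two gradients, the residual q of the forget gradient g
  after projecting out the retain gradient satisfies q \<bullet> g = q \<bullet> q and norm q = norm g * s, so the
  cosine of the angle between q and g is s. The chord between the two vectors of length \<rho> is
  therefore \<rho> * sqrt (2 * (1 - s)), and 1 - sqrt (1 - c^2) \<le> c^2 gives the bounds.
\<close>

text \<open>Trades the outer-product matrix for a multiple of \<open>v\<close>, so that all later
  work is done with inner products.\<close>

lemma line_proj_mult_vector: "line_proj v *v x = ((v \<bullet> x) / (norm v)\<^sup>2) *\<^sub>R v"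
  unfolding line_proj_def columnvector_def rowvector_def matrix_matrix_mult_def
    matrix_vector_mult_def inner_vec_def
  by (simp add: vec_eq_iff sum_distrib_left sum_distrib_right sum_divide_distrib mult_ac)

lemma residual_eq:
  "residual Lf Lr w = gradient Lf w
     - ((gradient Lr w \<bullet> gradient Lf w) / (norm (gradient Lr w))\<^sup>2) *\<^sub>R gradient Lr w"
  by (simp add: residual_def matrix_vector_mult_diff_rdistrib line_proj_mult_vector)

text \<open>Pythagoras: \<open>q\<close> is orthogonal to \<open>v\<close>, so its squared length is
  that of \<open>u\<close> minus that of the component of \<open>u\<close> along \<open>v\<close>,
  which is the fraction cos^2 of it.\<close>

lemma projection_residual:
  fixes u v :: "real ^ 'p"
  assumes "u \<noteq> 0" "v \<noteq> 0"
  defines "q \<equiv> u - ((v \<bullet> u) / (norm v)\<^sup>2) *\<^sub>R v"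
  shows inner_projection_residual: "q \<bullet> u = (norm q)\<^sup>2"
    and norm_projection_residual: "norm q = norm u * sin (vec_angle u v)"
proof -
  define a where "a = vec_angle u v"
  have c: "cos a = (u \<bullet> v) / (norm u * norm v)" and a: "a \<in> {0..pi}"
    unfolding a_def using vec_angle[OF assms(1,2)] by auto
  have "q \<bullet> v = 0"
    using \<open>v \<noteq> 0\<close> by (simp add: q_def inner_diff_left power2_norm_eq_inner inner_commute[of v u])
  then have "q \<bullet> q = q \<bullet> u"
    \<comment> \<open>Only the right factor of \<open>q \<bullet> q\<close> is expanded; its
      multiple of \<open>v\<close> is killed by orthogonality.\<close>
    by (subst (2) q_def) (simp add: inner_diff_right)
  then show qu: "q \<bullet> u = (norm q)\<^sup>2"
    by (simp add: power2_norm_eq_inner)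
  have "q \<bullet> u = (norm u)\<^sup>2 - (u \<bullet> v)\<^sup>2 / (norm v)\<^sup>2"
    by (simp add: q_def inner_diff_left inner_commute[of v u] dot_square_norm power2_eq_square[of "u \<bullet> v"])
  also have "\<dots> = (norm u)\<^sup>2 * (1 - (cos a)\<^sup>2)"
    using assms(1,2) by (simp add: c power_divide power_mult_distrib field_simps)
  also have "\<dots> = (norm u * sin a)\<^sup>2"
    by (simp add: sin_squared_eq power_mult_distrib)
  finally have "(norm q)\<^sup>2 = (norm u * sin a)\<^sup>2"
    by (simp add: qu)
  then show "norm q = norm u * sin (vec_angle u v)"
    unfolding a_def[symmetric]
    \<comment> \<open>The squares may be dropped because the sine is nonnegative on [0, pi].\<close>
    by (rule power2_eq_imp_eq) (use a in \<open>simp_all add: sin_ge_zero\<close>)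
qed

text \<open>Law of cosines for two vectors of common length \<open>r\<close>; the fraction is the
  cosine of the angle between them.\<close>

lemma norm_rescaled_diff:
  fixes u v :: "'a::real_inner"
  assumes "u \<noteq> 0" "v \<noteq> 0" "r \<ge> 0"
  shows "norm ((r / norm u) *\<^sub>R u - (r / norm v) *\<^sub>R v)
    = r * sqrt (2 * (1 - (u \<bullet> v) / (norm u * norm v)))"
proof -
  have "(norm ((r / norm u) *\<^sub>R u - (r / norm v) *\<^sub>R v))\<^sup>2
      = (r / norm u)\<^sup>2 * (norm u)\<^sup>2 + (r / norm v)\<^sup>2 * (norm v)\<^sup>2
        - 2 * ((r / norm u) * (r / norm v) * (u \<bullet> v))"
    unfolding power2_norm_eq_inner
    by (simp add: inner_diff_left inner_diff_right inner_commute power2_eq_square)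
  also have "\<dots> = r\<^sup>2 * (2 * (1 - (u \<bullet> v) / (norm u * norm v)))"
    using assms(1,2) by (simp add: field_simps power2_eq_square)
  finally have "norm ((r / norm u) *\<^sub>R u - (r / norm v) *\<^sub>R v)
      = sqrt (r\<^sup>2 * (2 * (1 - (u \<bullet> v) / (norm u * norm v))))"
    by (metis norm_ge_zero real_sqrt_unique)
  then show ?thesis
    using \<open>r \<ge> 0\<close> by (simp only: real_sqrt_mult real_sqrt_abs abs_of_nonneg)
qed

text \<open>For x = 1 - c^2 in [0, 1], x^2 \<le> x and hence x \<le> sqrt x.\<close>

lemma one_minus_sqrt_le:
  fixes c :: real
  assumes "c\<^sup>2 \<le> 1"
  shows "1 - sqrt (1 - c\<^sup>2) \<le> c\<^sup>2"
proof -
  have "(1 - c\<^sup>2)\<^sup>2 \<le> 1 - c\<^sup>2"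
    using assms by (simp add: power2_eq_square mult_left_le)
  then have "1 - c\<^sup>2 \<le> sqrt (1 - c\<^sup>2)"
    by (rule real_le_rsqrt)
  then show ?thesis by simp
qed

theorem proposition5:
  fixes Lf Lr :: "real ^ 'p \<Rightarrow> real" and w :: "real ^ 'p" and \<rho> :: real
  assumes "\<And>x. Lf differentiable (at x)"
    and "\<And>x. Lr differentiable (at x)"
    and "\<rho> > 0"
    and "gradient Lf w \<noteq> 0"
    and "gradient Lr w \<noteq> 0"
    and "residual Lf Lr w \<noteq> 0"
  shows "norm (delta_rosu Lf Lr \<rho> w - delta_std Lf \<rho> w) = \<rho> * sqrt (2 * (1 - sin (theta Lf Lr w)))
    \<and> \<rho> * sqrt (2 * (1 - sin (theta Lf Lr w)))
        = \<rho> * sqrt (2 * (1 - sqrt (1 - (cos (theta Lf Lr w))\<^sup>2)))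
    \<and> (\<forall>\<epsilon>\<in>{0..1}. \<bar>cos (theta Lf Lr w)\<bar> \<le> \<epsilon> \<longrightarrow>
          norm (delta_rosu Lf Lr \<rho> w - delta_std Lf \<rho> w) \<le> sqrt 2 * \<rho> * \<epsilon>
        \<and> (\<forall>Gr. Gr-lipschitz_on (perturbation_segment Lf Lr \<rho> w) Lr \<longrightarrow>
              \<bar>Lr (w + delta_rosu Lf Lr \<rho> w) - Lr (w + delta_std Lf \<rho> w)\<bar> \<le> sqrt 2 * Gr * \<rho> * \<epsilon>))"
proof -
  define f r q a where "f = gradient Lf w" and "r = gradient Lr w"
    and "q = residual Lf Lr w" and "a = theta Lf Lr w"
  note gen = f_def r_def q_def a_def
  have ne: "f \<noteq> 0" "r \<noteq> 0" "q \<noteq> 0"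
    using assms by (auto simp: gen)
  have nq: "norm q = norm f * sin a" and qf: "q \<bullet> f = (norm q)\<^sup>2"
    using norm_projection_residual[OF ne(1,2)] inner_projection_residual[OF ne(1,2)]
    by (simp_all add: gen theta_def residual_eq)
  have "(q \<bullet> f) / (norm q * norm f) = norm q / norm f"
    using ne by (simp add: qf power2_eq_square)
  also have "\<dots> = sin a"
    using ne nq by simp
  finally have ang: "(q \<bullet> f) / (norm q * norm f) = sin a" .
  have dist: "norm (delta_rosu Lf Lr \<rho> w - delta_std Lf \<rho> w) = \<rho> * sqrt (2 * (1 - sin a))"
    using norm_rescaled_diff[OF ne(3,1), of \<rho>] \<open>\<rho> > 0\<close> unfolding ang
    by (simp add: delta_rosu_def delta_std_def gen)
  have "a \<in> {0..pi}"
    using vec_angle(2)[OF ne(1,2)] by (simp add: gen theta_def)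
  \<comment> \<open>On [0, pi] the sine is the nonnegative root; this serves both the second
    equality and the bound.\<close>
  then have sin: "sin a = sqrt (1 - (cos a)\<^sup>2)"
    by (intro sin_cos_sqrt sin_ge_zero) auto
  have bound: "norm (delta_rosu Lf Lr \<rho> w - delta_std Lf \<rho> w) \<le> sqrt 2 * \<rho> * \<epsilon>"
    if "\<bar>cos a\<bar> \<le> \<epsilon>" for \<epsilon>
  proof -
    \<comment> \<open>By \<open>one_minus_sqrt_le\<close> at \<open>cos a\<close>; the root on the
      right is the absolute value of \<open>cos a\<close>.\<close>
    have "sqrt (1 - sin a) \<le> sqrt ((cos a)\<^sup>2)"
      unfolding sin by (intro real_sqrt_le_mono one_minus_sqrt_le) (simp add: abs_square_le_1)
    also have "\<dots> \<le> \<epsilon>"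
      using that by simp
    finally have "\<rho> * (sqrt 2 * sqrt (1 - sin a)) \<le> \<rho> * (sqrt 2 * \<epsilon>)"
      using \<open>\<rho> > 0\<close> by simp
    then show ?thesis
      unfolding dist real_sqrt_mult by (simp only: mult_ac)
  qed
  have lip: "\<bar>Lr (w + delta_rosu Lf Lr \<rho> w) - Lr (w + delta_std Lf \<rho> w)\<bar> \<le> sqrt 2 * Gr * \<rho> * \<epsilon>"
    if "\<bar>cos a\<bar> \<le> \<epsilon>" and L: "Gr-lipschitz_on (perturbation_segment Lf Lr \<rho> w) Lr" for \<epsilon> Gr
  proof -
    \<comment> \<open>The two perturbed points are the ends of the segment, at t = 1 and t =
      0.\<close>
    have "w + delta_rosu Lf Lr \<rho> w \<in> perturbation_segment Lf Lr \<rho> w"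
      unfolding perturbation_segment_def by (intro CollectI exI[of _ 1]) simp
    moreover have "w + delta_std Lf \<rho> w \<in> perturbation_segment Lf Lr \<rho> w"
      unfolding perturbation_segment_def by (intro CollectI exI[of _ 0]) simp
    ultimately have "\<bar>Lr (w + delta_rosu Lf Lr \<rho> w) - Lr (w + delta_std Lf \<rho> w)\<bar>
        \<le> Gr * norm (delta_rosu Lf Lr \<rho> w - delta_std Lf \<rho> w)"
      using lipschitz_onD[OF L, of "w + delta_rosu Lf Lr \<rho> w" "w + delta_std Lf \<rho> w"]
      by (simp add: dist_norm)
    also have "\<dots> \<le> Gr * (sqrt 2 * \<rho> * \<epsilon>)"
      \<comment> \<open>\<open>lipschitz_on\<close> includes 0 \<le> \<open>Gr\<close>, so
        multiplying by \<open>Gr\<close> preserves the bound.\<close>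
      using bound[OF that(1)] lipschitz_on_nonneg[OF L] by (rule mult_left_mono)
    finally show ?thesis
      by (simp only: mult_ac)
  qed
  show ?thesis
    \<comment> \<open>Folding the root back into the sine makes the second equality
      reflexive.\<close>
    using dist bound lip unfolding sin[unfolded a_def, symmetric] a_def by blast
qed

end
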